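(* The graded abelian subgroups $\mathit{Quilt}(n)\subset \mathit{F_2S}(n)\otimes\mathit{Brace}(n)$ ($n\ge1$) spanned by the sets $\mathsf{Quilt}(n)$ of quilts form a differential graded suboperad $\mathit{Quilt}$ of the Hadamard product dg-operad $\mathit{F_2S}\otimes_{\mathrm H}\mathit{Brace}$.
   Context: Write $\langle n\rangle=\{1,\dots,n\}$. TREES. A tree $T$ consists of a finite set $V_T$ (vertices), a set $E_T\subset V_T\times V_T$ (edges) and a partial order $\trianglelefteq_T$ on $V_T$ (strict part $\vartriangleleft_T$) such that: $(u,u)\notin E_T$; $E_T$ generates a partial order $\le_T$ with $(u,v)\in E_T\Rightarrow u<_Tv$; there is a unique $\le_T$-minimal vertex (the root); if $(u,v)\in E_T$ there is no $t$ with $u<_Tt<_Tv$; for all $u,v$ exactly one of $u=v$, $u<_Tv$, $u>_Tv$, $u\vartriangleleft_Tv$, $u\vartriangleright_Tv$ holds; if $u\vartriangleleft_Tv$, $u\le_Tu'$, $v\le_Tv'$ then $u'\vartriangleleft_Tv'$. If $(u,v)\in E_T$, $v$ is a child of $u$. $\mathsf{Tree}(n)$ is the set of trees with vertex set $\langle n\rangle$. WORDS. $\mathsf{F_2S}(n)$ is the set of words (finite sequences) $W$ over $\langle n\rangle$ such that every element of $\langle n\rangle$ appears, no element appears twice consecutively, and for $u\ne v$ there is no subsequence $u,v,u,v$. $|W|$ is the length and $\deg W=|W|-n$. Elements of $\langle n\rangle$ are called vertices. QUILTS. $\mathsf{Quilt}(n)$ is the set of pairs $Q=(W_Q,T_Q)\in\mathsf{F_2S}(n)\times\mathsf{Tree}(n)$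 such that (1) if some occurrence of $u$ precedes some occurrence of $v$ in $W_Q$ then not $u>_{T_Q}v$; (2) if some occurrence of $v$ lies between two occurrences of $u$ in $W_Q$ then $v\trianglelefteq_{T_Q}u$. $\deg Q=\deg W_Q$, arity $\#Q=n$. OCCURRENCES. $\underline a$ denotes an occurrence (position) of $a$ in $W$. The $\downarrow$ order is the order of first occurrences in $W$. An occurrence of $u$ is a caesura if $u$ occurs again later. If $W=\dots uv\dots u\dots$ ($v$ immediately after an occurrence of $u$, and $u$ occurs again later), $v$ is interposed; caesurae and interposed vertices correspond bijectively, and there are $\deg W$ of each. BOUNDARY. If $a$ is repeated in $W$, $\partial_{\underline a}W$ is $W$ with $\underline a$ deleted; otherwise $\partial_{\underline a}W=0$. Number the caesurae $1,2,\dots$ from left to right; if $\underline a$ is the $k$-th caesura, $\operatorname{sgn}_W\underline a=(-1)^k$; if $\underline a$ is the last occurrence of $a$ and the previous occurrence of $a$ is the $k$-th caesura, $\operatorname{sgn}_W\underline a=(-1)^{k+1}$. $\partial W=\sum_{\underline a}\operatorname{sgn}_W(\underline a)\,\partial_{\underline a}W$. PERMUTATIONS. $\sigma\in\mathbb S_n$ acts on words and trees on the right by replacing each vertex $u$ by $\sigma^{-1}(u)$. EXTENSIONS. For $a\in\langle m\rangle$ let $\alpha:\langle n\rangle\to\langle n+m-1\rangle$, $\alpha(j)=j+a-1$, and $\beta:\langle n+m-1\rangle\to\langle m\rangle$, $\beta(k)=k$ for $k<a$, $\beta(k)=a$ for $a\le k<a+n$, $\beta(k)=k+1-n$ for $k\ge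 a+n$. For $S\in\mathsf{Tree}(m)$, $T\in\mathsf{Tree}(n)$, $\mathrm{Ext}(S,T,a)$ is the set of $U\in\mathsf{Tree}(n+m-1)$ with: $(r,s)\in E_T\Leftrightarrow(\alpha r,\alpha s)\in E_U$; $r\vartriangleleft_Ts\Leftrightarrow\alpha r\vartriangleleft_U\alpha s$; $(u,w)\in E_U\Rightarrow(\beta u,\beta w)\in E_S$ or $\beta u=\beta w=a$; $\beta u\vartriangleleft_S\beta w\Rightarrow u\vartriangleleft_Uw$. For $V\in\mathsf{F_2S}(m)$, $W\in\mathsf{F_2S}(n)$, $\mathrm{Ext}(V,W,a)$ is the set of $X\in\mathsf{F_2S}(n+m-1)$ such that: deleting from $X$ all vertices not in the image of $\alpha$ and eliminating consecutive repetitions gives $W$ relabelled by $\alpha$; wherever letters have been deleted between two remaining letters, these two are equal (a repetition occurs there); relabelling $X$ by $\beta$ and eliminating consecutive repetitions gives $V$. Identify interposed vertices of $V$ and $W$ with interposed vertices of $X$: $w$ interposed in $W$ with $\alpha w$; $v\neq a$ interposed in $V$ with $\beta^{-1}(v)$; $a$, if interposed in $V$, with $\alpha w$ where $w$ is the first letter of $W$. $\operatorname{sgn}_{V,W,a}(X)$ is the sign of the shuffle from (interposed vertices of $V$ in $\downarrow$ order, then those of $W$ in $\downarrow$ order) to (interposed vertices of $X$ in $\downarrow$ order). OPERADS. $\mathit{Brace}(n)$ is the free abelian group on $\mathsf{Tree}(n)$ (degree $0$, zero differential) with $S\circ_aT=\sum_{U\in\mathrm{Ext}(S,T,a)}U$.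 $\mathit{F_2S}(n)$ is the free graded abelian group on $\mathsf{F_2S}(n)$ with differential $\partial$ (degree $-1$) and $V\circ_aW=\sum_{X\in\mathrm{Ext}(V,W,a)}\operatorname{sgn}_{V,W,a}(X)\,X$. $\mathit{Brace}$ is an operad and $\mathit{F_2S}$ is a dg-operad. The Hadamard product $\mathit{F_2S}\otimes_{\mathrm H}\mathit{Brace}$ has components $\mathit{F_2S}(n)\otimes\mathit{Brace}(n)$ (a pair $(W,T)$ stands for $W\otimes T$), diagonal permutation action, $\partial(W,T)=\partial W\otimes T$, and $(V,S)\circ_a(W,T)=(V\circ_aW)\otimes(S\circ_aT)$. *)

theory Defs
  imports
    "HOL-Algebra.Free_Abelian_Groups"
    "HOL-Algebra.Generated_Groups"
    "HOL-Combinatorics.Permutations"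
    "HOL-Library.Sublist"
begin

section \<open>Planar trees\<close>

text \<open>\<open>planar\<close> is the reflexive partial order \<open>\<trianglelefteq>\<close>; the tree order \<open>\<le>\<close> is the one generated by the edges.\<close>

record 'v ptree =
  verts :: "'v set"
  edges :: "('v \<times> 'v) set"
  planar :: "('v \<times> 'v) set"

definition tle :: "('v, 'z) ptree_scheme \<Rightarrow> 'v \<Rightarrow> 'v \<Rightarrow> bool" where
  "tle T u v \<longleftrightarrow> u \<in> verts T \<and> v \<in> verts T \<and> (u, v) \<in> (edges T)\<^sup>*"

definition tless :: "('v, 'z) ptree_scheme \<Rightarrow> 'v \<Rightarrow> 'v \<Rightarrow> bool" where
  "tless T u v \<longleftrightarrow> tle T u v \<and> u \<noteq> v"

definition pless :: "('v, 'z) ptree_scheme \<Rightarrow> 'v \<Rightarrow> 'v \<Rightarrow> bool" where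
  "pless T u v \<longleftrightarrow> (u, v) \<in> planar T \<and> u \<noteq> v"

definition is_tree :: "('v, 'z) ptree_scheme \<Rightarrow> bool" where
  "is_tree T \<longleftrightarrow>
     finite (verts T) \<and> edges T \<subseteq> verts T \<times> verts T \<and>
     partial_order_on (verts T) (planar T) \<and>
     (\<forall>u. (u, u) \<notin> edges T) \<and>
     partial_order_on (verts T) {(u, v). tle T u v} \<and>
     (\<forall>u v. (u, v) \<in> edges T \<longrightarrow> tless T u v) \<and>
     (\<exists>!r. r \<in> verts T \<and> (\<forall>v\<in>verts T. \<not> tless T v r)) \<and>
     (\<forall>u v. (u, v) \<in> edges T \<longrightarrow> \<not> (\<exists>t. tless T u t \<and> tless T t v)) \<and>
     (\<forall>u\<in>verts T. \<forall>v\<in>verts T.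
        length (filter (\<lambda>b. b) [u = v, tless T u v, tless T v u, pless T u v, pless T v u]) = 1) \<and>
     (\<forall>u v u' v'. pless T u v \<and> tle T u u' \<and> tle T v v' \<longrightarrow> pless T u' v')"

definition trees :: "nat \<Rightarrow> nat ptree set" where
  "trees n = {T. is_tree T \<and> verts T = {1..n}}"

section \<open>Words\<close>

definition words :: "nat \<Rightarrow> nat list set" where
  "words n = {W. set W = {1..n} \<and> distinct_adj W \<and>
                 (\<forall>u v. u \<noteq> v \<longrightarrow> \<not> subseq [u, v, u, v] W)}"

text \<open>Occurrences are positions, counted from 0.\<close>

definition caesura :: "'v list \<Rightarrow> nat \<Rightarrow> bool" where
  "caesura W i \<longleftrightarrow> i < length W \<and> (\<exists>j>i. j < length W \<and> W ! j = W ! i)"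

definition repeated :: "'v list \<Rightarrow> nat \<Rightarrow> bool" where
  "repeated W i \<longleftrightarrow> (\<exists>j<length W. j \<noteq> i \<and> W ! j = W ! i)"

definition caesura_number :: "'v list \<Rightarrow> nat \<Rightarrow> nat" where
  "caesura_number W i = card {j. j \<le> i \<and> caesura W j}"

definition prev_occ :: "'v list \<Rightarrow> nat \<Rightarrow> nat" where
  "prev_occ W i = Max {j. j < i \<and> W ! j = W ! i}"

text \<open>Only meaningful when the letter at position \<open>i\<close> is repeated.\<close>

definition occ_sgn :: "'v list \<Rightarrow> nat \<Rightarrow> int" where
  "occ_sgn W i = (if caesura W i then (- 1) ^ caesura_number W i
                  else (- 1) ^ (caesura_number W (prev_occ W i) + 1))"

definition occ_boundary :: "'v list \<Rightarrow> nat \<Rightarrow> 'v list \<Rightarrow>\<^sub>0 int" where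
  "occ_boundary W i = (if repeated W i then frag_of (take i W @ drop (Suc i) W) else 0)"

definition word_boundary :: "'v list \<Rightarrow> 'v list \<Rightarrow>\<^sub>0 int" where
  "word_boundary W = (\<Sum>i<length W. frag_cmul (occ_sgn W i) (occ_boundary W i))"

definition interposed :: "'v list \<Rightarrow> 'v \<Rightarrow> bool" where
  "interposed W v \<longleftrightarrow> (\<exists>i. Suc i < length W \<and> caesura W i \<and> W ! Suc i = v)"

text \<open>\<open>remdups\<close> keeps last occurrences, hence the reversals: the list is in order of
  first occurrences.\<close>

definition interposed_list :: "'v list \<Rightarrow> 'v list" where
  "interposed_list W = filter (interposed W) (rev (remdups (rev W)))"

section \<open>Quilts\<close>

definition quilts :: "nat \<Rightarrow> (nat list \<times> nat ptree) set" where
  "quilts n = {(W, T). W \<in> words n \<and> T \<in> trees n \<and>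
     (\<forall>i j. i < j \<and> j < length W \<longrightarrow> \<not> tless T (W ! j) (W ! i)) \<and>
     (\<forall>i k j. i < k \<and> k < j \<and> j < length W \<and> W ! i = W ! j \<longrightarrow> (W ! k, W ! i) \<in> planar T)}"

section \<open>Permutations and extensions\<close>

definition word_perm :: "nat list \<Rightarrow> (nat \<Rightarrow> nat) \<Rightarrow> nat list" where
  "word_perm W \<sigma> = map (inv_into UNIV \<sigma>) W"

definition tree_perm :: "nat ptree \<Rightarrow> (nat \<Rightarrow> nat) \<Rightarrow> nat ptree" where
  "tree_perm T \<sigma> = \<lparr>verts = inv_into UNIV \<sigma> ` verts T,
                    edges = map_prod (inv_into UNIV \<sigma>) (inv_into UNIV \<sigma>) ` edges T,
                    planar = map_prod (inv_into UNIV \<sigma>) (inv_into UNIV \<sigma>) ` planar T\<rparr>"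

definition ext_alpha :: "nat \<Rightarrow> nat \<Rightarrow> nat" where
  "ext_alpha a j = j + a - 1"

definition ext_beta :: "nat \<Rightarrow> nat \<Rightarrow> nat \<Rightarrow> nat" where
  "ext_beta n a k = (if k < a then k else if k < a + n then a else k + 1 - n)"

definition tree_ext :: "nat \<Rightarrow> nat \<Rightarrow> nat \<Rightarrow> nat ptree \<Rightarrow> nat ptree \<Rightarrow> nat ptree set" where
  "tree_ext m n a S T = {U \<in> trees (n + m - 1).
     (\<forall>r\<in>{1..n}. \<forall>s\<in>{1..n}. (r, s) \<in> edges T \<longleftrightarrow> (ext_alpha a r, ext_alpha a s) \<in> edges U) \<and>
     (\<forall>r\<in>{1..n}. \<forall>s\<in>{1..n}. pless T r s \<longleftrightarrow> pless U (ext_alpha a r) (ext_alpha a s)) \<and>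
     (\<forall>u w. (u, w) \<in> edges U \<longrightarrow>
        (ext_beta n a u, ext_beta n a w) \<in> edges S \<or> (ext_beta n a u = a \<and> ext_beta n a w = a)) \<and>
     (\<forall>u\<in>{1..n + m - 1}. \<forall>w\<in>{1..n + m - 1}.
        pless S (ext_beta n a u) (ext_beta n a w) \<longrightarrow> pless U u w)}"

definition word_ext :: "nat \<Rightarrow> nat \<Rightarrow> nat \<Rightarrow> nat list \<Rightarrow> nat list \<Rightarrow> nat list set" where
  "word_ext m n a V W = {X \<in> words (n + m - 1).
     remdups_adj (filter (\<lambda>x. x \<in> ext_alpha a ` {1..n}) X) = map (ext_alpha a) W \<and>
     (\<forall>i j. i + 1 < j \<and> j < length X \<and>
        X ! i \<in> ext_alpha a ` {1..n} \<and> X ! j \<in> ext_alpha a ` {1..n} \<and>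
        (\<forall>k. i < k \<and> k < j \<longrightarrow> X ! k \<notin> ext_alpha a ` {1..n}) \<longrightarrow> X ! i = X ! j) \<and>
     remdups_adj (map (ext_beta n a) X) = V}"

definition list_shuffle_sign :: "'v list \<Rightarrow> 'v list \<Rightarrow> int" where
  "list_shuffle_sign xs ys = sign (THE p. p permutes {..<length xs} \<and> permute_list p xs = ys)"

text \<open>The vertex of an extension that an interposed vertex \<open>v\<close> of the first word is identified with.\<close>

definition ext_ident :: "nat \<Rightarrow> nat \<Rightarrow> nat \<Rightarrow> nat list \<Rightarrow> nat \<Rightarrow> nat" where
  "ext_ident m n a W v = (if v = a then ext_alpha a (hd W)
                          else inv_into {1..n + m - 1} (ext_beta n a) v)"

definition ext_sgn :: "nat \<Rightarrow> nat \<Rightarrow> nat \<Rightarrow> nat list \<Rightarrow> nat list \<Rightarrow> nat list \<Rightarrow> int" where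
  "ext_sgn m n a V W X = list_shuffle_sign
     (map (ext_ident m n a W) (interposed_list V) @ map (ext_alpha a) (interposed_list W))
     (interposed_list X)"

section \<open>Symmetric dg-operads on free graded abelian groups\<close>

text \<open>Arity-\<open>n\<close> components are the free abelian groups on the sets \<open>gens n\<close> of homogeneous
  generators; \<open>bd_gen\<close>, \<open>perm_gen\<close> (right action) and \<open>circ_gen m n a\<close> (partial composition
  at \<open>a\<close> of arities \<open>m\<close> and \<open>n\<close>) are the values of the structure maps on generators.\<close>

record 'b based_operad =
  gens :: "nat \<Rightarrow> 'b set"
  deg :: "nat \<Rightarrow> 'b \<Rightarrow> int"
  bd_gen :: "nat \<Rightarrow> 'b \<Rightarrow> 'b \<Rightarrow>\<^sub>0 int"
  perm_gen :: "nat \<Rightarrow> 'b \<Rightarrow> (nat \<Rightarrow> nat) \<Rightarrow> 'b \<Rightarrow>\<^sub>0 int"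
  circ_gen :: "nat \<Rightarrow> nat \<Rightarrow> nat \<Rightarrow> 'b \<Rightarrow> 'b \<Rightarrow> 'b \<Rightarrow>\<^sub>0 int"
  op_unit :: "'b \<Rightarrow>\<^sub>0 int"

definition frag_extend2 ::
    "('a \<Rightarrow> 'b \<Rightarrow> 'c \<Rightarrow>\<^sub>0 int) \<Rightarrow> ('a \<Rightarrow>\<^sub>0 int) \<Rightarrow> ('b \<Rightarrow>\<^sub>0 int) \<Rightarrow> 'c \<Rightarrow>\<^sub>0 int" where
  "frag_extend2 f x y = frag_extend (\<lambda>p. frag_extend (f p) y) x"

definition op_group :: "'b based_operad \<Rightarrow> nat \<Rightarrow> ('b \<Rightarrow>\<^sub>0 int) monoid" where
  "op_group P n = free_Abelian_group (gens P n)"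

definition op_homog :: "'b based_operad \<Rightarrow> nat \<Rightarrow> int \<Rightarrow> ('b \<Rightarrow>\<^sub>0 int) set" where
  "op_homog P n d = carrier (free_Abelian_group {p \<in> gens P n. deg P n p = d})"

definition op_bd :: "'b based_operad \<Rightarrow> nat \<Rightarrow> ('b \<Rightarrow>\<^sub>0 int) \<Rightarrow> 'b \<Rightarrow>\<^sub>0 int" where
  "op_bd P n = frag_extend (bd_gen P n)"

definition op_perm :: "'b based_operad \<Rightarrow> nat \<Rightarrow> ('b \<Rightarrow>\<^sub>0 int) \<Rightarrow> (nat \<Rightarrow> nat) \<Rightarrow> 'b \<Rightarrow>\<^sub>0 int" where
  "op_perm P n x \<sigma> = frag_extend (\<lambda>p. perm_gen P n p \<sigma>) x"

definition op_circ ::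
    "'b based_operad \<Rightarrow> nat \<Rightarrow> nat \<Rightarrow> nat \<Rightarrow> ('b \<Rightarrow>\<^sub>0 int) \<Rightarrow> ('b \<Rightarrow>\<^sub>0 int) \<Rightarrow> 'b \<Rightarrow>\<^sub>0 int" where
  "op_circ P m n a = frag_extend2 (circ_gen P m n a)"

text \<open>The dg-operad axioms are identities between the structure maps, so a family of graded subgroups
  closed under these maps inherits them from \<open>P\<close>.\<close>

definition dg_suboperad :: "'b based_operad \<Rightarrow> (nat \<Rightarrow> ('b \<Rightarrow>\<^sub>0 int) set) \<Rightarrow> bool" where
  "dg_suboperad P S \<longleftrightarrow>
     (\<forall>n\<ge>1. subgroup (S n) (op_group P n)) \<and>
     (\<forall>n\<ge>1. S n = generate (op_group P n) (\<Union>d. S n \<inter> op_homog P n d)) \<and>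
     (\<forall>n\<ge>1. \<forall>x\<in>S n. op_bd P n x \<in> S n) \<and>
     (\<forall>n\<ge>1. \<forall>x\<in>S n. \<forall>\<sigma>. \<sigma> permutes {1..n} \<longrightarrow> op_perm P n x \<sigma> \<in> S n) \<and>
     op_unit P \<in> S 1 \<and>
     (\<forall>m\<ge>1. \<forall>n\<ge>1. \<forall>a\<in>{1..m}. \<forall>x\<in>S m. \<forall>y\<in>S n. op_circ P m n a x y \<in> S (m + n - 1))"

text \<open>A tensor product of free abelian groups is the free abelian group on pairs of generators.\<close>

definition tensor :: "('a \<Rightarrow>\<^sub>0 int) \<Rightarrow> ('b \<Rightarrow>\<^sub>0 int) \<Rightarrow> ('a \<times> 'b) \<Rightarrow>\<^sub>0 int" where
  "tensor = frag_extend2 (\<lambda>p q. frag_of (p, q))"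

definition koszul :: "int \<Rightarrow> int" where
  "koszul k = (if even k then 1 else - 1)"

definition hadamard :: "'a based_operad \<Rightarrow> 'b based_operad \<Rightarrow> ('a \<times> 'b) based_operad" where
  "hadamard P Q = \<lparr>
     gens = (\<lambda>n. gens P n \<times> gens Q n),
     deg = (\<lambda>n (p, q). deg P n p + deg Q n q),
     bd_gen = (\<lambda>n (p, q). tensor (bd_gen P n p) (frag_of q) +
                 frag_cmul (koszul (deg P n p)) (tensor (frag_of p) (bd_gen Q n q))),
     perm_gen = (\<lambda>n (p, q) \<sigma>. tensor (perm_gen P n p \<sigma>) (perm_gen Q n q \<sigma>)),
     circ_gen = (\<lambda>m n a (p, q) (p', q').
                   frag_cmul (koszul (deg Q m q * deg P n p'))
                     (tensor (circ_gen P m n a p p') (circ_gen Q m n a q q'))),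
     op_unit = tensor (op_unit P) (op_unit Q)\<rparr>"

definition F2S :: "nat list based_operad" where
  "F2S = \<lparr>
     gens = words,
     deg = (\<lambda>n W. int (length W) - int n),
     bd_gen = (\<lambda>n. word_boundary),
     perm_gen = (\<lambda>n W \<sigma>. frag_of (word_perm W \<sigma>)),
     circ_gen = (\<lambda>m n a V W. \<Sum>X\<in>word_ext m n a V W. frag_cmul (ext_sgn m n a V W X) (frag_of X)),
     op_unit = frag_of [1]\<rparr>"

definition Brace :: "nat ptree based_operad" where
  "Brace = \<lparr>
     gens = trees,
     deg = (\<lambda>n T. 0),
     bd_gen = (\<lambda>n T. 0),
     perm_gen = (\<lambda>n T \<sigma>. frag_of (tree_perm T \<sigma>)),
     circ_gen = (\<lambda>m n a S T. \<Sum>U\<in>tree_ext m n a S T. frag_of U),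
     op_unit = frag_of \<lparr>verts = {1}, edges = {}, planar = {(1, 1)}\<rparr>\<rparr>"

text \<open>Since Brace is concentrated in degree 0 and has zero differential, the Koszul signs disappear.\<close>

lemma hadamard_F2S_Brace:
  "bd_gen (hadamard F2S Brace) n (W, T) = tensor (word_boundary W) (frag_of T)"
  "perm_gen (hadamard F2S Brace) n (W, T) \<sigma> = frag_of (word_perm W \<sigma>, tree_perm T \<sigma>)"
  "circ_gen (hadamard F2S Brace) m n a (V, S) (W, T) =
     tensor (circ_gen F2S m n a V W) (circ_gen Brace m n a S T)"
  by (simp_all add: hadamard_def F2S_def Brace_def tensor_def frag_extend2_def koszul_def)

definition Quilt :: "nat \<Rightarrow> ((nat list \<times> nat ptree) \<Rightarrow>\<^sub>0 int) set" where
  "Quilt n = generate (op_group (hadamard F2S Brace) n) (frag_of ` quilts n)"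

end

theory Submission
  imports Defs
begin

text \<open>Both quilt conditions only speak about subsequences \<open>u v\<close> and \<open>u v u\<close> of the word with
  \<open>u \<noteq> v\<close>. Such subsequences pass to subwords, which gives closure under the boundary. In a
  composite \<open>(X, U)\<close>, a subsequence without adjacent repetitions survives the collapse of \<open>X\<close>
  along \<open>\<beta>\<close> when \<open>\<beta> u \<noteq> \<beta> v\<close>, and otherwise it survives the restriction to the image of \<open>\<alpha>\<close>;
  the order relations of \<open>U\<close> are related to those of \<open>S\<close> in the first case and to those of \<open>T\<close> in the
  second one, so a violation in \<open>(X, U)\<close> yields a violation in \<open>(V, S)\<close> or in \<open>(W, T)\<close>.\<close>

section \<open>Subsequences\<close>

text \<open>Peels one letter off a pattern. Iterating it turns patterns into increasing positions,
  the form in which \<open>quilts\<close> states its conditions.\<close>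

lemma subseq_Cons_iff_nth:
  "subseq (x # xs) zs \<longleftrightarrow> (\<exists>i<length zs. zs ! i = x \<and> subseq xs (drop (Suc i) zs))"
proof
  assume "subseq (x # xs) zs"
  then obtain us v vs where "zs = us @ v # vs" "x = v" "subseq xs vs"
    by (auto dest: list_emb_ConsD)
  then show "\<exists>i<length zs. zs ! i = x \<and> subseq xs (drop (Suc i) zs)"
    by (intro exI[of _ "length us"]) auto
next
  assume "\<exists>i<length zs. zs ! i = x \<and> subseq xs (drop (Suc i) zs)"
  then obtain i where i: "i < length zs" "zs ! i = x" "subseq xs (drop (Suc i) zs)" by blast
  then have "subseq (x # xs) (x # drop (Suc i) zs)" by simp
  also have "x # drop (Suc i) zs = drop i zs" using i by (metis Cons_nth_drop_Suc)
  also have "subseq \<dots> zs" by (metis append_take_drop_id list_emb_append2 subseq_order.order_refl)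
  finally show "subseq (x # xs) zs" .
qed

lemma subseq2_iff_nth:
  "subseq [x, y] zs \<longleftrightarrow> (\<exists>i j. i < j \<and> j < length zs \<and> zs ! i = x \<and> zs ! j = y)"
proof
  assume "subseq [x, y] zs"
  then obtain i j where "i < length zs" "zs ! i = x" "j < length zs - Suc i" "zs ! (Suc i + j) = y"
    by (auto simp: subseq_Cons_iff_nth)
  then show "\<exists>i j. i < j \<and> j < length zs \<and> zs ! i = x \<and> zs ! j = y"
    by (intro exI[of _ i] exI[of _ "Suc i + j"]) auto
next
  assume "\<exists>i j. i < j \<and> j < length zs \<and> zs ! i = x \<and> zs ! j = y"
  then obtain i j where "i < j" "j < length zs" "zs ! i = x" "zs ! j = y" by blast
  then have "i < length zs \<and> zs ! i = x \<and> subseq [y] (drop (Suc i) zs)"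
    by (auto simp: subseq_singleton_left in_set_conv_nth intro!: exI[of _ "j - Suc i"])
  then show "subseq [x, y] zs"
    by (subst subseq_Cons_iff_nth) blast
qed

lemma subseq3_iff_nth:
  "subseq [x, y, z] zs \<longleftrightarrow>
     (\<exists>i k j. i < k \<and> k < j \<and> j < length zs \<and> zs ! i = x \<and> zs ! k = y \<and> zs ! j = z)"
proof
  assume "subseq [x, y, z] zs"
  then obtain i k j where "i < length zs" "zs ! i = x" "k < j" "j < length zs - Suc i"
      "zs ! (Suc i + k) = y" "zs ! (Suc i + j) = z"
    by (subst (asm) subseq_Cons_iff_nth) (auto simp: subseq2_iff_nth)
  then show "\<exists>i k j. i < k \<and> k < j \<and> j < length zs \<and> zs ! i = x \<and> zs ! k = y \<and> zs ! j = z"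
    by (intro exI[of _ i] exI[of _ "Suc i + k"] exI[of _ "Suc i + j"]) auto
next
  assume "\<exists>i k j. i < k \<and> k < j \<and> j < length zs \<and> zs ! i = x \<and> zs ! k = y \<and> zs ! j = z"
  then obtain i k j where "i < k" "k < j" "j < length zs" "zs ! i = x" "zs ! k = y" "zs ! j = z"
    by blast
  moreover from this have "subseq [y, z] (drop (Suc i) zs)"
    unfolding subseq2_iff_nth by (intro exI[of _ "k - Suc i"] exI[of _ "j - Suc i"]) auto
  ultimately have "i < length zs \<and> zs ! i = x \<and> subseq [y, z] (drop (Suc i) zs)" by simp
  then show "subseq [x, y, z] zs"
    by (subst subseq_Cons_iff_nth) blast
qed

text \<open>A run of equal adjacent letters can serve at most one letter of \<open>xs\<close>,
  because \<open>xs\<close> has no adjacent repetition; shrinking each run to one letter therefore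
  loses nothing.\<close>

lemma subseq_remdups_adj:
  assumes "distinct_adj xs" "subseq xs ys"
  shows "subseq xs (remdups_adj ys)"
  using assms
proof (induction ys arbitrary: xs rule: remdups_adj.induct)
  case (3 x y ys)
  show ?case
  proof (cases "x = y")
    case True
    \<comment> \<open>If \<open>xs\<close> matches its head with the first copy of \<open>x\<close>,
      its second letter differs from \<open>x\<close> and skips the second copy.\<close>
    have "subseq xs (x # ys)"
      using "3.prems" True by (cases xs rule: remdups_adj.cases) (auto split: if_splits)
    then show ?thesis using 3 True by simp
  next
    case False
    show ?thesis
    proof (cases xs)
      case (Cons z zs)
      then have "distinct_adj zs" using "3.prems" by (cases zs) auto
      then show ?thesis using 3 False Cons by (auto split: if_splits)
    qed simp
  qed
qed auto

lemma subseq_delete_nth: "subseq (take i xs @ drop (Suc i) xs) xs"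
proof (cases "i < length xs")
  case True
  then have "subseq (take i xs @ drop (Suc i) xs) (take i xs @ xs ! i # drop (Suc i) xs)"
    by (intro list_emb_append_mono) auto
  then show ?thesis using True by (simp add: id_take_nth_drop[symmetric])
qed simp

section \<open>Quilts\<close>

text \<open>Patterns, unlike positions, are carried along directly by deletion, relabelling,
  filtering and collapsing of words.\<close>

lemma quilts_iff_subseq:
  "(W, T) \<in> quilts n \<longleftrightarrow> W \<in> words n \<and> T \<in> trees n \<and>
     (\<forall>u v. subseq [u, v] W \<longrightarrow> \<not> tless T v u) \<and>
     (\<forall>u v. subseq [u, v, u] W \<longrightarrow> (v, u) \<in> planar T)"
proof -
  have "(\<forall>i j. i < j \<and> j < length W \<longrightarrow> \<not> tless T (W ! j) (W ! i)) \<longleftrightarrow>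
      (\<forall>u v. subseq [u, v] W \<longrightarrow> \<not> tless T v u)"
    by (auto simp: subseq2_iff_nth)
  moreover have "(\<forall>i k j. i < k \<and> k < j \<and> j < length W \<and> W ! i = W ! j \<longrightarrow> (W ! k, W ! i) \<in> planar T) \<longleftrightarrow>
      (\<forall>u v. subseq [u, v, u] W \<longrightarrow> (v, u) \<in> planar T)"
    unfolding subseq3_iff_nth by fastforce
  ultimately show ?thesis by (simp add: quilts_def)
qed

lemma quilts_subword:
  assumes "(W, T) \<in> quilts n" "subseq W' W" "W' \<in> words n"
  shows "(W', T) \<in> quilts n"
  using assms unfolding quilts_iff_subseq by (blast intro: subseq_order.trans)

text \<open>A repeated letter cannot have equal neighbours, by the pattern \<open>u v u v\<close>; hence deleting it
  creates no adjacent repetition.\<close>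

lemma words_delete_repeated:
  assumes W: "W \<in> words n" and i: "i < length W" "repeated W i"
  shows "take i W @ drop (Suc i) W \<in> words n"
proof -
  let ?v = "W ! i" and ?A = "take i W" and ?B = "drop (Suc i) W"
  have split: "W = ?A @ ?v # ?B" using i by (simp add: id_take_nth_drop[symmetric])
  have adj: "distinct_adj (?A @ ?v # ?B)" using W split by (auto simp: words_def)
  have no_alt: "\<not> subseq [x, y, x, y] W" if "x \<noteq> y" for x y
    using W that by (auto simp: words_def)
  obtain j where j: "j < length W" "j \<noteq> i" "W ! j = ?v" using i by (auto simp: repeated_def)
  have v_mem: "?v \<in> set ?A \<union> set ?B"
  proof (cases "j < i")
    case True
    then have "?A ! j = ?v" "j < length ?A" using j i by auto
    then show ?thesis by (metis nth_mem UnI1)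
  next
    case False
    then have "?B ! (j - Suc i) = ?v" "j - Suc i < length ?B" using j i by auto
    then show ?thesis by (metis nth_mem UnI2)
  qed
  have "last ?A \<noteq> hd ?B" if ne: "?A \<noteq> []" "?B \<noteq> []"
  proof
    assume eq: "last ?A = hd ?B"
    define u where "u = hd ?B"
    obtain A' where A: "?A = A' @ [u]" using ne eq u_def by (metis append_butlast_last_id)
    obtain B' where B: "?B = u # B'" using ne u_def by (metis list.collapse)
    have uv: "u \<noteq> ?v" using adj unfolding A B by (auto simp: distinct_adj_append_iff)
    \<comment> \<open>The deleted letter occurs elsewhere. A copy before both neighbours gives the
      pattern \<open>?v u ?v u\<close>, a copy after both gives \<open>u ?v u ?v\<close>.\<close>
    from v_mem uv A B consider "?v \<in> set A'" | "?v \<in> set B'" by auto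
    then show False
    proof cases
      case 1
      then have "subseq ([?v] @ [u, ?v, u]) (A' @ [u, ?v, u] @ B')"
        by (intro list_emb_append_mono) (auto simp: subseq_singleton_left)
      then show False using no_alt[of ?v u] uv split A B by (metis append.assoc append_Cons append_Nil)
    next
      case 2
      then have "subseq ([] @ [u, ?v, u] @ [?v]) (A' @ [u, ?v, u] @ B')"
        by (intro list_emb_append_mono) (auto simp: subseq_singleton_left)
      then show False using no_alt[of u ?v] uv split A B by (metis append.assoc append_Cons append_Nil)
    qed
  qed
  then have "distinct_adj (?A @ ?B)"
    using adj by (auto simp: distinct_adj_append_iff distinct_adj_Cons)
  moreover have "set (?A @ ?B) = set W" using v_mem by (subst (3) split) auto
  moreover have "\<not> subseq [x, y, x, y] (?A @ ?B)" if "x \<noteq> y" for x y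
    using no_alt[OF that] subseq_order.trans[OF _ subseq_delete_nth] by blast
  ultimately show ?thesis using W by (simp add: words_def)
qed

section \<open>Relabelling of trees and quilts by permutations\<close>

lemma is_treeD:
  assumes "is_tree T"
  shows "finite (verts T)" "edges T \<subseteq> verts T \<times> verts T"
    and "partial_order_on (verts T) (planar T)"
    and "(u, u) \<notin> edges T"
    and "partial_order_on (verts T) {(u, v). tle T u v}"
    and "(u, v) \<in> edges T \<Longrightarrow> tless T u v"
    and "\<exists>!r. r \<in> verts T \<and> (\<forall>v\<in>verts T. \<not> tless T v r)"
    and "(u, v) \<in> edges T \<Longrightarrow> \<not> (tless T u t \<and> tless T t v)"
    and "\<lbrakk>u \<in> verts T; v \<in> verts T\<rbrakk> \<Longrightarrow>
      length (filter (\<lambda>b. b) [u = v, tless T u v, tless T v u, pless T u v, pless T v u]) = 1"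
    and "\<lbrakk>pless T u v; tle T u u'; tle T v v'\<rbrakk> \<Longrightarrow> pless T u' v'"
  using assms unfolding is_tree_def by blast+

text \<open>A path between two image points may run through arbitrary intermediate points;
  surjectivity of \<open>f\<close> pulls these back.\<close>

lemma rtrancl_inv_image:
  assumes "bij f"
  shows "(inv_image r f)\<^sup>* = inv_image (r\<^sup>*) f"
proof -
  have "(f u, f v) \<in> r\<^sup>*" if "(u, v) \<in> (inv_image r f)\<^sup>*" for u v
    using that by induction (auto intro: rtrancl_into_rtrancl)
  moreover have "(inv_into UNIV f x, inv_into UNIV f y) \<in> (inv_image r f)\<^sup>*" if "(x, y) \<in> r\<^sup>*" for x y
    using that
  proof induction
    case (step y z)
    then have "(inv_into UNIV f y, inv_into UNIV f z) \<in> inv_image r f"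
      using assms by (simp add: bij_is_surj surj_f_inv_f)
    then show ?case using step.IH by (rule rtrancl_into_rtrancl[rotated])
  qed simp
  ultimately show ?thesis
    using assms by (force simp: bij_is_inj)
qed

text \<open>Images under the inverse of \<sigma> are preimages under \<sigma>, so a statement about
  the relabelled tree at \<open>u\<close> becomes one about \<open>T\<close> at
  \<open>\<sigma> u\<close>.\<close>

lemma tree_perm_sel:
  assumes "bij \<sigma>"
  shows "u \<in> verts (tree_perm T \<sigma>) \<longleftrightarrow> \<sigma> u \<in> verts T"
    and "edges (tree_perm T \<sigma>) = inv_image (edges T) \<sigma>"
    and "planar (tree_perm T \<sigma>) = inv_image (planar T) \<sigma>"
    and "tle (tree_perm T \<sigma>) u v \<longleftrightarrow> tle T (\<sigma> u) (\<sigma> v)"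
    and "tless (tree_perm T \<sigma>) u v \<longleftrightarrow> tless T (\<sigma> u) (\<sigma> v)"
    and "pless (tree_perm T \<sigma>) u v \<longleftrightarrow> pless T (\<sigma> u) (\<sigma> v)"
proof -
  have inj: "inj \<sigma>" and surj: "surj \<sigma>" using assms by (auto simp: bij_def)
  have img: "map_prod (inv_into UNIV \<sigma>) (inv_into UNIV \<sigma>) ` r = inv_image r \<sigma>" for r
    using inj surj by (force simp: map_prod_def surj_f_inv_f image_iff)
  show v: "u \<in> verts (tree_perm T \<sigma>) \<longleftrightarrow> \<sigma> u \<in> verts T" for u
    using inj surj by (force simp: tree_perm_def surj_f_inv_f image_iff)
  show e: "edges (tree_perm T \<sigma>) = inv_image (edges T) \<sigma>"
    and p: "planar (tree_perm T \<sigma>) = inv_image (planar T) \<sigma>"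
    by (simp_all add: tree_perm_def img)
  show t: "tle (tree_perm T \<sigma>) u v \<longleftrightarrow> tle T (\<sigma> u) (\<sigma> v)"
    by (simp add: tle_def v e rtrancl_inv_image[OF assms])
  show "tless (tree_perm T \<sigma>) u v \<longleftrightarrow> tless T (\<sigma> u) (\<sigma> v)"
    using inj by (simp add: tless_def t inj_eq)
  show "pless (tree_perm T \<sigma>) u v \<longleftrightarrow> pless T (\<sigma> u) (\<sigma> v)"
    using inj by (simp add: pless_def p inj_eq)
qed

lemma partial_order_on_inv_image:
  assumes "inj f" "partial_order_on A r"
  shows "partial_order_on (f -` A) (inv_image r f)"
proof -
  have A: "r \<subseteq> A \<times> A" "refl_on A r" "trans r" "antisym r"
    using assms(2) by (auto simp: partial_order_on_def preorder_on_def)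
  have "inv_image r f \<subseteq> (f -` A) \<times> (f -` A)"
    using A(1) by auto
  moreover have "refl_on (f -` A) (inv_image r f)"
    using A(2) by (simp add: refl_on_def)
  moreover have "trans (inv_image r f)"
    using A(3) by (rule trans_inv_image)
  moreover have "antisym (inv_image r f)"
  proof (rule antisymI)
    fix x y assume "(x, y) \<in> inv_image r f" "(y, x) \<in> inv_image r f"
    then have "f x = f y" using antisymD[OF A(4)] by simp
    then show "x = y" by (rule injD[OF assms(1)])
  qed
  ultimately show ?thesis by (simp add: partial_order_on_def preorder_on_def)
qed

lemma is_tree_tree_perm:
  assumes \<sigma>: "bij \<sigma>" and T: "is_tree T"
  shows "is_tree (tree_perm T \<sigma>)"
proof -
  have inj: "inj \<sigma>" and surj: "surj \<sigma>" using \<sigma> by (auto simp: bij_def)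
  note sel = tree_perm_sel[OF \<sigma>]
  have verts: "verts (tree_perm T \<sigma>) = \<sigma> -` verts T" using sel(1) by auto
  have order: "{(u, v). tle (tree_perm T \<sigma>) u v} = inv_image {(u, v). tle T u v} \<sigma>"
    by (auto simp: sel)
  have surjD: "\<exists>x. y = \<sigma> x" for y using surj by blast
  have root: "\<exists>!r. r \<in> verts (tree_perm T \<sigma>) \<and>
      (\<forall>v\<in>verts (tree_perm T \<sigma>). \<not> tless (tree_perm T \<sigma>) v r)"
  proof -
    have ex1: "\<exists>!r. r \<in> verts T \<and> (\<forall>v\<in>verts T. \<not> tless T v r)"
      using T by (rule is_treeD)
    then obtain r where "r \<in> verts T" "\<forall>v\<in>verts T. \<not> tless T v r" by blast
    moreover obtain s where "r = \<sigma> s" using surjD by blast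
    \<comment> \<open>Minimality is tested against all vertices of \<open>T\<close>, each of which
      has the form \<open>\<sigma> x\<close>.\<close>
    moreover have is_root: "\<forall>v\<in>verts T. \<not> tless T v (\<sigma> q)"
      if "\<forall>v\<in>verts (tree_perm T \<sigma>). \<not> tless (tree_perm T \<sigma>) v q" for q
    proof
      fix v assume "v \<in> verts T"
      then show "\<not> tless T v (\<sigma> q)" using that surjD[of v] by (auto simp: sel)
    qed
    ultimately show ?thesis
    proof (intro ex1I[of _ s])
      fix q assume "q \<in> verts (tree_perm T \<sigma>) \<and>
        (\<forall>v\<in>verts (tree_perm T \<sigma>). \<not> tless (tree_perm T \<sigma>) v q)"
      then have "\<sigma> q = r"
        using ex1 is_root[of q] \<open>r \<in> verts T\<close> \<open>\<forall>v\<in>verts T. \<not> tless T v r\<close> sel(1) by blast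
      then show "q = s" using \<open>r = \<sigma> s\<close> inj by (simp add: inj_eq)
    qed (auto simp: sel)
  qed
  show ?thesis
    unfolding is_tree_def
  proof (intro conjI)
    show "finite (verts (tree_perm T \<sigma>))"
      using is_treeD(1)[OF T] inj by (simp add: verts finite_vimageI)
    show "edges (tree_perm T \<sigma>) \<subseteq> verts (tree_perm T \<sigma>) \<times> verts (tree_perm T \<sigma>)"
      using is_treeD(2)[OF T] by (auto simp: sel)
    show "partial_order_on (verts (tree_perm T \<sigma>)) (planar (tree_perm T \<sigma>))"
      unfolding verts sel by (intro partial_order_on_inv_image inj is_treeD(3) T)
    show "\<forall>u. (u, u) \<notin> edges (tree_perm T \<sigma>)"
      using is_treeD(4)[OF T] by (simp add: sel)
    show "partial_order_on (verts (tree_perm T \<sigma>)) {(u, v). tle (tree_perm T \<sigma>) u v}"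
      unfolding verts order by (intro partial_order_on_inv_image inj is_treeD(5) T)
    show "\<forall>u v. (u, v) \<in> edges (tree_perm T \<sigma>) \<longrightarrow> tless (tree_perm T \<sigma>) u v"
      using is_treeD(6)[OF T] by (simp add: sel)
    show "\<exists>!r. r \<in> verts (tree_perm T \<sigma>) \<and>
        (\<forall>v\<in>verts (tree_perm T \<sigma>). \<not> tless (tree_perm T \<sigma>) v r)"
      by (rule root)
    show "\<forall>u v. (u, v) \<in> edges (tree_perm T \<sigma>) \<longrightarrow>
        \<not> (\<exists>t. tless (tree_perm T \<sigma>) u t \<and> tless (tree_perm T \<sigma>) t v)"
      unfolding sel in_inv_image using is_treeD(8)[OF T] by blast
    \<comment> \<open>Injectivity of \<sigma> turns the first alternative
      \<open>\<sigma> u = \<sigma> v\<close> of the condition for \<open>T\<close> into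
      \<open>u = v\<close>.\<close>
    show "\<forall>u\<in>verts (tree_perm T \<sigma>). \<forall>v\<in>verts (tree_perm T \<sigma>).
        length (filter (\<lambda>b. b) [u = v, tless (tree_perm T \<sigma>) u v, tless (tree_perm T \<sigma>) v u,
          pless (tree_perm T \<sigma>) u v, pless (tree_perm T \<sigma>) v u]) = 1"
      unfolding sel by (intro ballI) (rule is_treeD(9)[OF T, of "\<sigma> _" "\<sigma> _", unfolded inj_eq[OF inj]], (simp add: sel)+)
    show "\<forall>u v u' v'. pless (tree_perm T \<sigma>) u v \<and> tle (tree_perm T \<sigma>) u u' \<and>
        tle (tree_perm T \<sigma>) v v' \<longrightarrow> pless (tree_perm T \<sigma>) u' v'"
      unfolding sel using is_treeD(10)[OF T] by blast
  qed
qed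

lemma quilts_perm:
  assumes q: "(W, T) \<in> quilts n" and \<sigma>: "\<sigma> permutes {1..n}"
  shows "(word_perm W \<sigma>, tree_perm T \<sigma>) \<in> quilts n"
proof -
  have bij: "bij \<sigma>" using \<sigma> by (rule permutes_bij)
  have inj': "inj (inv_into UNIV \<sigma>)" using bij by (simp add: bij_betw_inv_into bij_is_inj)
  have \<sigma>inv: "\<sigma> (inv_into UNIV \<sigma> x) = x" for x using bij by (simp add: bij_is_surj surj_f_inv_f)
  have map_back: "map \<sigma> (word_perm W \<sigma>) = W"
    by (simp add: word_perm_def o_def \<sigma>inv)
  \<comment> \<open>Applying \<sigma> undoes the relabelling, so a violating pattern in the new word
    would already violate the conditions in \<open>W\<close>.\<close>
  have sub: "subseq (map \<sigma> xs) W" if "subseq xs (word_perm W \<sigma>)" for xs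
    using subseq_map[OF that, of \<sigma>] map_back by simp
  have W: "W \<in> words n" and T: "T \<in> trees n"
    and c1: "\<And>u v. subseq [u, v] W \<Longrightarrow> \<not> tless T v u"
    and c2: "\<And>u v. subseq [u, v, u] W \<Longrightarrow> (v, u) \<in> planar T"
    using q by (auto simp: quilts_iff_subseq)
  have "inv_into UNIV \<sigma> ` {1..n} = {1..n}" using \<sigma> by (metis permutes_image permutes_inv)
  moreover have "distinct_adj (word_perm W \<sigma>)"
    using W inj' by (simp add: words_def word_perm_def distinct_adj_map_iff inj_on_subset)
  moreover have "\<not> subseq [u, v, u, v] (word_perm W \<sigma>)" if "u \<noteq> v" for u v
    using W sub[of "[u, v, u, v]"] that bij by (auto simp: words_def bij_is_inj inj_eq)
  ultimately have "word_perm W \<sigma> \<in> words n"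
    using W by (auto simp: words_def word_perm_def)
  moreover have "verts (tree_perm T \<sigma>) = {1..n}"
    using T \<open>inv_into UNIV \<sigma> ` {1..n} = {1..n}\<close> by (simp add: trees_def tree_perm_def)
  then have "tree_perm T \<sigma> \<in> trees n"
    using T is_tree_tree_perm[OF bij] by (simp add: trees_def)
  ultimately show ?thesis
    using sub c1 c2 by (fastforce simp: quilts_iff_subseq tree_perm_sel[OF bij])
qed

lemma is_tree_singleton: "is_tree \<lparr>verts = {x}, edges = {}, planar = {(x, x)}\<rparr>"
  (is "is_tree ?T")
proof -
  have tle: "tle ?T u v \<longleftrightarrow> u = x \<and> v = x" and less: "\<not> tless ?T u v" "\<not> pless ?T u v" for u v
    by (auto simp: tle_def tless_def pless_def)
  have "partial_order_on {x} {(x, x)}"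
    by (auto simp: partial_order_on_def preorder_on_def refl_on_def trans_def antisym_def)
  moreover have "{(u, v). tle ?T u v} = {(x, x)}" by (auto simp: tle)
  ultimately show ?thesis unfolding is_tree_def by (simp add: less)
qed

lemma quilts_unit: "([1], \<lparr>verts = {1}, edges = {}, planar = {(1, 1)}\<rparr>) \<in> quilts 1"
  using is_tree_singleton[of "1 :: nat"] by (simp add: quilts_def words_def trees_def)

section \<open>Extensions and the composition of quilts\<close>

lemma ext_beta_alpha: "\<lbrakk>r \<in> {1..n}; a \<ge> 1\<rbrakk> \<Longrightarrow> ext_beta n a (ext_alpha a r) = a"
  by (auto simp: ext_beta_def ext_alpha_def)

text \<open>The fibre over \<open>a\<close> is the block from \<open>a\<close> to
  \<open>a + n - 1\<close>; the witness \<open>u + 1 - a\<close> inverts the shift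
  \<open>j + a - 1\<close>.\<close>

lemma ext_beta_fibre:
  assumes "ext_beta n a u = a" "n \<ge> 1" "a \<ge> 1"
  obtains r where "r \<in> {1..n}" "u = ext_alpha a r"
  using assms by (intro that[of "u + 1 - a"]) (auto simp: ext_beta_def ext_alpha_def split: if_splits)

text \<open>Outside the block over \<open>a\<close> the map is injective and misses
  \<open>a\<close>, so only this fibre can contain two distinct vertices.\<close>

lemma ext_beta_eqD:
  assumes "ext_beta n a u = ext_beta n a v" "u \<noteq> v" "n \<ge> 1"
  shows "ext_beta n a u = a"
  using assms by (auto simp: ext_beta_def split: if_splits)

text \<open>For \<open>a \<ge> 1\<close> the natural subtraction never truncates; at
  \<open>a = 0\<close> the values at 0 and 1 would coincide.\<close>

lemma inj_ext_alpha: "a \<ge> 1 \<Longrightarrow> inj (ext_alpha a)"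
  by (auto simp: inj_def ext_alpha_def)

text \<open>The two conditions travel in opposite directions. The first forbids a tree relation, so
  paths of \<open>U\<close> are pushed down to \<open>S\<close> or \<open>T\<close>; the second
  demands a planar relation, so planar relations of \<open>S\<close> or \<open>T\<close> are lifted
  to \<open>U\<close>.\<close>

lemma quilts_ext:
  assumes a: "a \<in> {1..m}" and n: "n \<ge> 1"
    and VS: "(V, S) \<in> quilts m" and WT: "(W, T) \<in> quilts n"
    and X: "X \<in> word_ext m n a V W" and U: "U \<in> tree_ext m n a S T"
  shows "(X, U) \<in> quilts (m + n - 1)"
proof -
  define \<alpha> \<beta> where "\<alpha> = ext_alpha a" and "\<beta> = ext_beta n a"
  have a1: "a \<ge> 1" using a by simp
  have \<alpha>_eq: "\<alpha> r = \<alpha> s \<longleftrightarrow> r = s" for r s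
    using inj_ext_alpha[OF a1] by (auto simp: \<alpha>_def inj_eq)
  have X_words: "X \<in> words (m + n - 1)"
    and X_W: "remdups_adj (filter (\<lambda>x. x \<in> \<alpha> ` {1..n}) X) = map \<alpha> W"
    and X_V: "remdups_adj (map \<beta> X) = V"
    using X unfolding word_ext_def mem_Collect_eq \<alpha>_def \<beta>_def add.commute[of n m] by blast+
  have U_trees: "U \<in> trees (m + n - 1)"
    and U_edges_T: "\<And>r s. \<lbrakk>r \<in> {1..n}; s \<in> {1..n}\<rbrakk> \<Longrightarrow> (\<alpha> r, \<alpha> s) \<in> edges U \<Longrightarrow> (r, s) \<in> edges T"
    and U_pless_T: "\<And>r s. \<lbrakk>r \<in> {1..n}; s \<in> {1..n}\<rbrakk> \<Longrightarrow> pless T r s \<Longrightarrow> pless U (\<alpha> r) (\<alpha> s)"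
    and U_edges_S: "\<And>u w. (u, w) \<in> edges U \<Longrightarrow> (\<beta> u, \<beta> w) \<in> edges S \<or> (\<beta> u = a \<and> \<beta> w = a)"
    and U_pless_S: "\<And>u w. \<lbrakk>u \<in> {1..m + n - 1}; w \<in> {1..m + n - 1}\<rbrakk> \<Longrightarrow> pless S (\<beta> u) (\<beta> w) \<Longrightarrow> pless U u w"
    using U unfolding tree_ext_def mem_Collect_eq \<alpha>_def \<beta>_def add.commute[of n m] by blast+
  have U_tree: "is_tree U" and U_verts: "verts U = {1..m + n - 1}"
    using U_trees by (auto simp: trees_def)
  have S_tree: "is_tree S" and S_verts: "verts S = {1..m}" and T_verts: "verts T = {1..n}"
    and V1: "\<And>u v. subseq [u, v] V \<Longrightarrow> \<not> tless S v u"
    and V2: "\<And>u v. subseq [u, v, u] V \<Longrightarrow> (v, u) \<in> planar S"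
    and W1: "\<And>u v. subseq [u, v] W \<Longrightarrow> \<not> tless T v u"
    and W2: "\<And>u v. subseq [u, v, u] W \<Longrightarrow> (v, u) \<in> planar T"
    using VS WT by (auto simp: quilts_iff_subseq trees_def)
  have X_set: "x \<in> {1..m + n - 1}" if xs: "subseq xs X" "x \<in> set xs" for x xs
  proof -
    obtain y where "y \<in> set X" "x = y" using list_emb_set[OF xs] by blast
    then show ?thesis using X_words by (simp add: words_def)
  qed
  have refl_U: "(u, u) \<in> planar U" if "u \<in> {1..m + n - 1}" for u
    using that is_treeD(3)[OF U_tree] U_verts
    by (simp add: partial_order_on_def preorder_on_def refl_on_def)
  have \<beta>_range: "\<beta> u \<in> verts S" if "u \<in> {1..m + n - 1}" for u
    using that a n by (auto simp: \<beta>_def ext_beta_def S_verts)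
  \<comment> \<open>Adjacent letters of the pattern must stay distinct under \<beta>; this is why
    patterns inside one fibre are sent to \<open>W\<close> instead.\<close>
  have sub_V: "subseq (map \<beta> xs) V" if "subseq xs X" "distinct_adj (map \<beta> xs)" for xs
    using subseq_remdups_adj[OF that(2) subseq_map[OF that(1)]] unfolding X_V .
  have sub_W: "subseq rs W" if "subseq (map \<alpha> rs) X" "distinct_adj rs" "set rs \<subseteq> {1..n}" for rs
  proof -
    have "subseq (filter (\<lambda>x. x \<in> \<alpha> ` {1..n}) (map \<alpha> rs)) (filter (\<lambda>x. x \<in> \<alpha> ` {1..n}) X)"
      using that(1) by (rule subseq_filter)
    also have "filter (\<lambda>x. x \<in> \<alpha> ` {1..n}) (map \<alpha> rs) = map \<alpha> rs"
      using that(3) by (intro filter_True) auto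
    finally have "subseq (map \<alpha> rs) (filter (\<lambda>x. x \<in> \<alpha> ` {1..n}) X)" .
    moreover have "distinct_adj (map \<alpha> rs)"
      using that(2) by (simp add: distinct_adj_map_iff inj_on_def \<alpha>_eq)
    ultimately have "subseq (map \<alpha> rs) (map \<alpha> W)"
      unfolding X_W[symmetric] by (rule subseq_remdups_adj[rotated])
    \<comment> \<open>The pattern has been found in the relabelled word; the inverse of the
      injection \<alpha> carries it back to \<open>W\<close>.\<close>
    then have "subseq (map (inv_into UNIV \<alpha>) (map \<alpha> rs)) (map (inv_into UNIV \<alpha>) (map \<alpha> W))" by (rule subseq_map)
    moreover have "inv_into UNIV \<alpha> \<circ> \<alpha> = id" by (simp add: inj_def \<alpha>_eq)
    ultimately show ?thesis by simp
  qed
  have fibre: "\<exists>r\<in>{1..n}. u = \<alpha> r" if "\<beta> u = a" for u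
    using that n a1 unfolding \<alpha>_def \<beta>_def by (blast elim: ext_beta_fibre)
  \<comment> \<open>Each edge of \<open>U\<close> maps to an edge of \<open>S\<close> or is
    contracted to \<open>a\<close>.\<close>
  have \<beta>_path: "(\<beta> u, \<beta> v) \<in> (edges S)\<^sup>*" if "(u, v) \<in> (edges U)\<^sup>*" for u v
    using that
  proof induction
    case (step y z)
    then show ?case using U_edges_S[of y z] by (metis rtrancl.rtrancl_into_rtrancl)
  qed simp
  have S_antisym: "x = y" if "(x, y) \<in> (edges S)\<^sup>*" "(y, x) \<in> (edges S)\<^sup>*" "x \<in> verts S" "y \<in> verts S" for x y
    using is_treeD(5)[OF S_tree] that by (simp add: partial_order_on_def antisym_def tle_def)
  have U_edge_verts: "u \<in> {1..m + n - 1} \<and> v \<in> {1..m + n - 1}" if "(u, v) \<in> edges U" for u v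
    using that is_treeD(2)[OF U_tree] U_verts by auto
  text \<open>By antisymmetry in \<open>S\<close>, a path of \<open>U\<close> between two vertices over \<open>a\<close> stays over \<open>a\<close>.\<close>
  have fibre_path: "\<exists>r s. r \<in> {1..n} \<and> s \<in> {1..n} \<and> u = \<alpha> r \<and> v = \<alpha> s \<and> (r, s) \<in> (edges T)\<^sup>*"
    if "(u, v) \<in> (edges U)\<^sup>*" "\<beta> u = a" "\<beta> v = a" for u v
    using that
  proof (induction rule: rtrancl_induct)
    case base
    then show ?case using fibre by blast
  next
    case (step y z)
    have "(a, \<beta> y) \<in> (edges S)\<^sup>*" using \<beta>_path[OF step.hyps(1)] step.prems by simp
    moreover have "(\<beta> y, a) \<in> (edges S)\<^sup>*" using \<beta>_path[OF r_into_rtrancl[OF step.hyps(2)]] step.prems by simp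
    ultimately have "\<beta> y = a"
      using S_antisym[of "\<beta> y" a] \<beta>_range U_edge_verts[OF step.hyps(2)] a S_verts by auto
    then obtain r s where rs: "r \<in> {1..n}" "s \<in> {1..n}" "u = \<alpha> r" "y = \<alpha> s" "(r, s) \<in> (edges T)\<^sup>*"
      using step.IH step.prems(1) by blast
    obtain t where t: "t \<in> {1..n}" "z = \<alpha> t"
      using fibre[OF step.prems(2)] by blast
    \<comment> \<open>Both ends of the last edge now lie over \<open>a\<close>, where edges of
      \<open>U\<close> are exactly edges of \<open>T\<close>.\<close>
    have "(s, t) \<in> edges T" using U_edges_T[of s t] step.hyps(2) rs t by simp
    then have "(r, t) \<in> (edges T)\<^sup>*" using rs(5) by simp
    then show ?case using rs t by blast
  qed
  have "\<not> tless U v u" if uv: "subseq [u, v] X" for u v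
  proof
    assume less: "tless U v u"
    then have path: "(v, u) \<in> (edges U)\<^sup>*" and ne: "u \<noteq> v" by (auto simp: tless_def tle_def)
    have mem: "u \<in> {1..m + n - 1}" "v \<in> {1..m + n - 1}" using X_set[OF uv] by auto
    show False
    proof (cases "\<beta> u = \<beta> v")
      case False
      then have "tless S (\<beta> v) (\<beta> u)"
        using \<beta>_path[OF path] \<beta>_range mem by (auto simp: tless_def tle_def)
      then show False using V1 sub_V[OF uv] False by auto
    next
      case True
      then have "\<beta> u = a" "\<beta> v = a" using ext_beta_eqD[of n a u v] ne n by (auto simp: \<beta>_def)
      then obtain r s where rs: "r \<in> {1..n}" "s \<in> {1..n}" "v = \<alpha> r" "u = \<alpha> s" "(r, s) \<in> (edges T)\<^sup>*"
        using fibre_path[OF path] by blast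
      then have "tless T r s" using ne T_verts by (auto simp: tless_def tle_def)
      moreover have "subseq [s, r] W" using sub_W[of "[s, r]"] uv rs ne by auto
      ultimately show False using W1 by blast
    qed
  qed
  moreover have "(v, u) \<in> planar U" if uvu: "subseq [u, v, u] X" for u v
  proof -
    have mem: "u \<in> {1..m + n - 1}" "v \<in> {1..m + n - 1}" using X_set[OF uvu] by auto
    consider "u = v" | "\<beta> u \<noteq> \<beta> v" | "u \<noteq> v" "\<beta> u = \<beta> v" by blast
    then show ?thesis
    proof cases
      \<comment> \<open>The pattern form of the second condition allows \<open>u = v\<close>;
        reflexivity of the planar order settles it.\<close>
      case 1
      then show ?thesis using refl_U mem by simp
    next
      case 2
      \<comment> \<open>Extensions lift only strict planar relations; strictness comes from
        \<open>\<beta> u \<noteq> \<beta> v\<close>.\<close>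
      then have "pless S (\<beta> v) (\<beta> u)" using V2[of "\<beta> u" "\<beta> v"] sub_V[OF uvu] by (auto simp: pless_def)
      then show ?thesis using U_pless_S mem by (auto simp: pless_def)
    next
      case 3
      then have "\<beta> u = a" "\<beta> v = a" using ext_beta_eqD[of n a u v] n by (auto simp: \<beta>_def)
      then obtain r s where rs: "r \<in> {1..n}" "s \<in> {1..n}" "u = \<alpha> r" "v = \<alpha> s"
        using fibre by blast
      then have "subseq [r, s, r] W" using sub_W[of "[r, s, r]"] uvu 3 by auto
      then have "pless T s r" using W2 rs 3 by (auto simp: pless_def)
      then show ?thesis using U_pless_T[of s r] rs by (auto simp: pless_def)
    qed
  qed
  ultimately show ?thesis using X_words U_trees by (auto simp: quilts_iff_subseq)
qed

section \<open>Free abelian groups\<close>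

text \<open>Turns membership in the spanned subgroup into a condition on supports, so that each
  closure property can be checked on generators.\<close>

lemma generate_frag_of:
  assumes "Q \<subseteq> G"
  shows "generate (free_Abelian_group G) (frag_of ` Q) = {c. Poly_Mapping.keys c \<subseteq> Q}"
proof
  interpret group "free_Abelian_group G" by simp
  have "subgroup {c :: 'a \<Rightarrow>\<^sub>0 int. Poly_Mapping.keys c \<subseteq> Q} (free_Abelian_group G)"
  proof (rule subgroupI)
    fix c d :: "'a \<Rightarrow>\<^sub>0 int" assume "c \<in> {c. Poly_Mapping.keys c \<subseteq> Q}" "d \<in> {c. Poly_Mapping.keys c \<subseteq> Q}"
    then show "c \<otimes>\<^bsub>free_Abelian_group G\<^esub> d \<in> {c. Poly_Mapping.keys c \<subseteq> Q}"
      using keys_add[of c d] by auto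
  qed (use assms in auto)
  then show "generate (free_Abelian_group G) (frag_of ` Q) \<subseteq> {c. Poly_Mapping.keys c \<subseteq> Q}"
    by (rule generate_subgroup_incl[rotated]) auto
  \<comment> \<open>\<open>frag_induction\<close> builds \<open>c\<close> from zero, generators in
    \<open>Q\<close> and differences.\<close>
  have "c \<in> generate (free_Abelian_group G) (frag_of ` Q)" if "Poly_Mapping.keys c \<subseteq> Q" for c
    using that
  proof (induction c rule: frag_induction)
    case zero
    then show ?case using generate.one[of "free_Abelian_group G"] by simp
  next
    case (one x)
    then show ?case by (auto intro: generate.incl)
  next
    case (diff c d)
    have sub: "subgroup (generate (free_Abelian_group G) (frag_of ` Q)) (free_Abelian_group G)"
      by (rule generate_is_subgroup) (use assms in auto)
    \<comment> \<open>The group inverse is identified with unary minus only on the carrier.\<close>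
    have "d \<in> carrier (free_Abelian_group G)" using diff(2) sub subgroup.subset by blast
    then have "inv\<^bsub>free_Abelian_group G\<^esub> d = - d" by simp
    then have "c \<otimes>\<^bsub>free_Abelian_group G\<^esub> (- d) \<in> generate (free_Abelian_group G) (frag_of ` Q)"
      using subgroup.m_closed[OF sub diff(1)] subgroup.m_inv_closed[OF sub diff(2)] by metis
    then show ?case by simp
  qed
  then show "{c. Poly_Mapping.keys c \<subseteq> Q} \<subseteq> generate (free_Abelian_group G) (frag_of ` Q)" by blast
qed

lemma keys_frag_extend_subset:
  assumes "\<And>p. p \<in> Poly_Mapping.keys x \<Longrightarrow> Poly_Mapping.keys (f p) \<subseteq> A"
  shows "Poly_Mapping.keys (frag_extend f x) \<subseteq> A"
  using keys_frag_extend[of f x] assms by blast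

lemma keys_frag_extend2_subset:
  assumes "\<And>p q. \<lbrakk>p \<in> Poly_Mapping.keys x; q \<in> Poly_Mapping.keys y\<rbrakk> \<Longrightarrow> Poly_Mapping.keys (f p q) \<subseteq> A"
  shows "Poly_Mapping.keys (frag_extend2 f x y) \<subseteq> A"
  unfolding frag_extend2_def by (intro keys_frag_extend_subset assms)

lemma keys_tensor_subset:
  "Poly_Mapping.keys (tensor x y) \<subseteq> Poly_Mapping.keys x \<times> Poly_Mapping.keys y"
  unfolding tensor_def
  by (rule keys_frag_extend2_subset, simp only: keys_frag_of, blast)

text \<open>Coefficients cannot enlarge a support, so arbitrary signs are allowed: those of the
  boundary as well as the shuffle signs.\<close>

lemma keys_sum_frag_cmul_subset:
  assumes "\<And>i. i \<in> I \<Longrightarrow> Poly_Mapping.keys (f i) \<subseteq> A"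
  shows "Poly_Mapping.keys (\<Sum>i\<in>I. frag_cmul (c i) (f i)) \<subseteq> A"
proof -
  note keys_sum
  also have "(\<Union>i\<in>I. Poly_Mapping.keys (frag_cmul (c i) (f i))) \<subseteq> A"
    by (rule UN_least) (rule order_trans[OF keys_cmul assms])
  finally show ?thesis .
qed

section \<open>The suboperad\<close>

lemma gens_hadamard: "gens (hadamard F2S Brace) n = words n \<times> trees n"
  by (simp add: hadamard_def F2S_def Brace_def)

lemma quilts_subset: "quilts n \<subseteq> words n \<times> trees n"
  by (auto simp: quilts_def)

lemma Quilt_eq: "Quilt n = {c. Poly_Mapping.keys c \<subseteq> quilts n}"
  unfolding Quilt_def op_group_def gens_hadamard by (rule generate_frag_of[OF quilts_subset])

lemma subgroup_Quilt: "subgroup (Quilt n) (op_group (hadamard F2S Brace) n)"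
  unfolding Quilt_def op_group_def gens_hadamard
  by (rule group.generate_is_subgroup) (use quilts_subset[of n] in auto)

lemma Quilt_graded:
  "Quilt n = generate (op_group (hadamard F2S Brace) n)
     (\<Union>d. Quilt n \<inter> op_homog (hadamard F2S Brace) n d)" (is "_ = generate ?G ?H")
proof
  \<comment> \<open>A generator is homogeneous of its own degree.\<close>
  have "frag_of ` quilts n \<subseteq> ?H"
    using quilts_subset[of n] by (auto simp: Quilt_eq op_homog_def gens_hadamard)
  then show "Quilt n \<subseteq> generate ?G ?H"
    unfolding Quilt_def by (intro group.mono_generate) (simp_all add: op_group_def)
  show "generate ?G ?H \<subseteq> Quilt n"
    by (rule group.generate_subgroup_incl[OF _ _ subgroup_Quilt]) (auto simp: op_group_def)
qed

lemma Quilt_boundary: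
  assumes "x \<in> Quilt n"
  shows "op_bd (hadamard F2S Brace) n x \<in> Quilt n"
proof -
  have "Poly_Mapping.keys (tensor (word_boundary W) (frag_of T)) \<subseteq> quilts n"
    if q: "(W, T) \<in> quilts n" for W T
  proof -
    \<comment> \<open>The tree stays fixed. An unrepeated letter contributes zero; deleting a
      repeated one gives a subword that is again in \<open>words n\<close>.\<close>
    have "Poly_Mapping.keys (occ_boundary W i) \<subseteq> {W'. (W', T) \<in> quilts n}" if "i < length W" for i
      using q that words_delete_repeated quilts_subword[OF q subseq_delete_nth]
      by (auto simp: occ_boundary_def quilts_def)
    then have "Poly_Mapping.keys (word_boundary W) \<subseteq> {W'. (W', T) \<in> quilts n}"
      unfolding word_boundary_def by (intro keys_sum_frag_cmul_subset) auto
    then show ?thesis using keys_tensor_subset by fastforce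
  qed
  then show ?thesis
    using assms unfolding Quilt_eq op_bd_def mem_Collect_eq
    by (intro keys_frag_extend_subset) (metis hadamard_F2S_Brace(1) subsetD surj_pair)
qed

lemma Quilt_perm:
  assumes "x \<in> Quilt n" "\<sigma> permutes {1..n}"
  shows "op_perm (hadamard F2S Brace) n x \<sigma> \<in> Quilt n"
  using assms quilts_perm unfolding Quilt_eq op_perm_def mem_Collect_eq
  by (intro keys_frag_extend_subset) (auto simp: hadamard_F2S_Brace)

lemma Quilt_unit: "op_unit (hadamard F2S Brace) \<in> Quilt 1"
  using quilts_unit
  by (simp add: hadamard_def F2S_def Brace_def tensor_def frag_extend2_def Quilt_eq)

text \<open>The composite of two generators is supported on pairs of a word extension and a tree
  extension chosen independently; \<open>quilts_ext\<close> makes every such pair a quilt.\<close>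

lemma Quilt_circ:
  assumes a: "a \<in> {1..m}" and n: "n \<ge> 1" and "x \<in> Quilt m" "y \<in> Quilt n"
  shows "op_circ (hadamard F2S Brace) m n a x y \<in> Quilt (m + n - 1)"
proof -
  have "Poly_Mapping.keys (circ_gen (hadamard F2S Brace) m n a (V, S) (W, T)) \<subseteq> quilts (m + n - 1)"
    if q: "(V, S) \<in> quilts m" "(W, T) \<in> quilts n" for V S W T
  proof -
    have "Poly_Mapping.keys (circ_gen F2S m n a V W) \<subseteq> word_ext m n a V W"
      by (simp add: F2S_def keys_sum_frag_cmul_subset)
    \<comment> \<open>The composite of trees has no signs; the constant coefficient 1 brings it into
      the form of the general support bound.\<close>
    moreover have "Poly_Mapping.keys (circ_gen Brace m n a S T) \<subseteq> tree_ext m n a S T"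
      using keys_sum_frag_cmul_subset[of "tree_ext m n a S T" frag_of _ "\<lambda>_. 1"]
      by (simp add: Brace_def)
    ultimately have "Poly_Mapping.keys (circ_gen (hadamard F2S Brace) m n a (V, S) (W, T))
        \<subseteq> word_ext m n a V W \<times> tree_ext m n a S T"
      unfolding hadamard_F2S_Brace using keys_tensor_subset by (rule order_trans[rotated, OF Sigma_mono])
    also have "\<dots> \<subseteq> quilts (m + n - 1)"
      using quilts_ext[OF a n q] by blast
    finally show ?thesis .
  qed
  then have "Poly_Mapping.keys (circ_gen (hadamard F2S Brace) m n a p q) \<subseteq> quilts (m + n - 1)"
    if "p \<in> quilts m" "q \<in> quilts n" for p q
    using that by (cases p, cases q) blast
  then show ?thesis
    using assms(3,4) unfolding Quilt_eq op_circ_def mem_Collect_eq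
    by (intro keys_frag_extend2_subset) blast
qed

theorem theorem3p5:
  shows "dg_suboperad (hadamard F2S Brace) Quilt"
  unfolding dg_suboperad_def
  using subgroup_Quilt Quilt_graded Quilt_boundary Quilt_perm Quilt_unit Quilt_circ by blast

end
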